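(* Let $I$ be an ideal of a commutative ring $R$. Then $R$ with the $I$-adic topology is an absolute topological ring.
   Context: Rings are commutative with identity. The $I$-adic topology on $R$ is the topology having as a base of open sets all cosets $a+I^{n}$ with $a\in R$ and $n\geqslant 1$. A topological ring is a ring with a topology for which the ring operations are continuous. For a ring $R$, $R^{\ast}=\{a\in R:\exists b\in R,\ ab=1\}$ is its group of units. An absolute topological ring is a topological ring $R$ such that $R^{\ast}$, with the subspace topology induced from $R$, is a topological group (i.e. multiplication and inversion on $R^{\ast}$ are continuous). *)

theory Defs
  imports "HOL-Analysis.Product_Topology" "HOL-Algebra.Ideal_Product"
begin

locale topological_group = group G for G (structure) +
  fixes T :: "'a topology"
  assumes topspace_eq: "topspace T = carrier G"
    and continuous_mult:
      "continuous_map (prod_topology T T) T (\<lambda>(x, y). x \<otimes> y)"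
    and continuous_inv: "continuous_map T T (\<lambda>x. inv x)"

locale topological_ring = cring R for R (structure) +
  fixes T :: "'a topology"
  assumes topspace_eq: "topspace T = carrier R"
    and continuous_add:
      "continuous_map (prod_topology T T) T (\<lambda>(x, y). x \<oplus> y)"
    and continuous_minus: "continuous_map T T (\<lambda>x. \<ominus> x)"
    and continuous_mult:
      "continuous_map (prod_topology T T) T (\<lambda>(x, y). x \<otimes> y)"

locale absolute_topological_ring = topological_ring +
  assumes units_topological_group:
    "topological_group (units_of R) (subtopology T (Units R))"

text \<open>Powers of an ideal are taken in the library's multiplicative monoid of ideals, whose
  product is the ideal product (finite sums of products of elements).\<close>

definition adic_base :: "('a, 'b) ring_scheme \<Rightarrow> 'a set \<Rightarrow> 'a set set" where
  "adic_base R I =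
    {a <+\<^bsub>R\<^esub> (I [^]\<^bsub>ideals_set R\<^esub> n) | a (n::nat). a \<in> carrier R \<and> n \<ge> 1}"

definition adic_topology :: "('a, 'b) ring_scheme \<Rightarrow> 'a set \<Rightarrow> 'a topology" where
  "adic_topology R I = topology (arbitrary union_of (\<lambda>U. U \<in> adic_base R I))"

text \<open>The following facts show that the cosets do form a base, so that the abstraction function
  \<open>topology\<close> above is applied to an actual topology.\<close>

context cring
begin

lemma ideal_pow_Suc:
  "I [^]\<^bsub>ideals_set R\<^esub> Suc n = (I [^]\<^bsub>ideals_set R\<^esub> n) \<cdot> I"
  by (simp add: nat_pow_def ideals_set_def)

lemma ideal_pow_is_ideal:
  assumes "ideal I R"
  shows "ideal (I [^]\<^bsub>ideals_set R\<^esub> (n::nat)) R"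
proof (induction n)
  case 0
  then show ?case by (simp add: nat_pow_def ideals_set_def oneideal)
next
  case (Suc n)
  then show ?case using assms by (simp only: ideal_pow_Suc ideal_prod_is_ideal)
qed

lemma ideal_pow_antimono:
  assumes "ideal I R" and "m \<le> n"
  shows "I [^]\<^bsub>ideals_set R\<^esub> n \<subseteq> I [^]\<^bsub>ideals_set R\<^esub> (m::nat)"
  using assms(2)
proof (induction n rule: dec_induct)
  case base
  then show ?case by simp
next
  case (step n)
  have "I [^]\<^bsub>ideals_set R\<^esub> Suc n \<subseteq> I [^]\<^bsub>ideals_set R\<^esub> n"
    unfolding ideal_pow_Suc
    using ideal_prod_inter[OF ideal_pow_is_ideal[OF assms(1)] assms(1)] by blast
  then show ?case using step by blast
qed

lemma coset_subset_coset:
  assumes "ideal J R" "ideal K R" "K \<subseteq> J" "a \<in> carrier R" "x \<in> a <+ J"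
  shows "x <+ K \<subseteq> a <+ J"
proof
  fix y assume "y \<in> x <+ K"
  then obtain k where k: "k \<in> K" "y = x \<oplus> k"
    by (auto simp: a_l_coset_def')
  obtain j where j: "j \<in> J" "x = a \<oplus> j"
    using assms(5) by (auto simp: a_l_coset_def')
  have "j \<oplus> k \<in> J"
    using k j assms(1,3) by (meson additive_subgroup.a_closed ideal.axioms(1) subsetD)
  moreover have "y = a \<oplus> (j \<oplus> k)"
    using k j assms(1,2,4) by (simp add: a_assoc ideal.Icarr)
  ultimately show "y \<in> a <+ J"
    by (auto simp: a_l_coset_def')
qed

lemma mem_coset_self:
  assumes "ideal J R" "x \<in> carrier R"
  shows "x \<in> x <+ J"
proof -
  have "\<zero> \<in> J" using assms(1) by (simp add: additive_subgroup.zero_closed ideal.axioms(1))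
  moreover have "x = x \<oplus> \<zero>" using assms(2) by simp
  ultimately show ?thesis unfolding a_l_coset_def' by blast
qed

lemma coset_in_carrier:
  assumes "ideal J R" "a \<in> carrier R"
  shows "a <+ J \<subseteq> carrier R"
  using assms by (auto simp: a_l_coset_def' ideal.Icarr)

lemma istopology_adic:
  assumes I: "ideal I R"
  shows "istopology (arbitrary union_of (\<lambda>U. U \<in> adic_base R I))"
  unfolding istopology_base_eq
proof (intro allI impI, elim conjE)
  fix S T assume "S \<in> adic_base R I" "T \<in> adic_base R I"
  then obtain a b and m n :: nat where
    S: "a \<in> carrier R" "m \<ge> 1" "S = a <+ (I [^]\<^bsub>ideals_set R\<^esub> m)" and
    T: "b \<in> carrier R" "n \<ge> 1" "T = b <+ (I [^]\<^bsub>ideals_set R\<^esub> n)"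
    by (auto simp: adic_base_def)
  have "\<exists>U. U \<in> adic_base R I \<and> x \<in> U \<and> U \<subseteq> S \<inter> T" if x: "x \<in> S \<inter> T" for x
  proof -
    let ?U = "x <+ (I [^]\<^bsub>ideals_set R\<^esub> max m n)"
    have xR: "x \<in> carrier R"
      using x S coset_in_carrier[OF ideal_pow_is_ideal[OF I] S(1)] by blast
    have "?U \<in> adic_base R I"
      unfolding adic_base_def using xR S(2)
      by (intro CollectI exI[of _ x] exI[of _ "max m n"]) auto
    moreover have "x \<in> ?U"
      by (rule mem_coset_self[OF ideal_pow_is_ideal[OF I] xR])
    moreover have "?U \<subseteq> S"
      unfolding S(3) using x S
      by (intro coset_subset_coset ideal_pow_is_ideal ideal_pow_antimono I) auto
    moreover have "?U \<subseteq> T"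
      unfolding T(3) using x T
      by (intro coset_subset_coset ideal_pow_is_ideal ideal_pow_antimono I) auto
    ultimately show ?thesis by blast
  qed
  then have "S \<inter> T = \<Union>{U \<in> adic_base R I. U \<subseteq> S \<inter> T}" by blast
  then show "(arbitrary union_of (\<lambda>U. U \<in> adic_base R I)) (S \<inter> T)"
    unfolding union_of_def arbitrary_def by (intro exI[of _ "{U \<in> adic_base R I. U \<subseteq> S \<inter> T}"]) auto
qed

lemma openin_adic_topology:
  assumes "ideal I R"
  shows "openin (adic_topology R I) U \<longleftrightarrow> (\<exists>\<B> \<subseteq> adic_base R I. U = \<Union>\<B>)"
  using topology_inverse'[OF istopology_adic[OF assms]]
  by (auto simp: adic_topology_def union_of_def arbitrary_def)

end

end

theory Submission
  imports Defs "HOL-Analysis.Abstract_Limits"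
begin

text \<open>For every \<open>n\<close> the cosets of \<open>I\<^sup>n\<close> are the classes of the congruence modulo the ideal \<open>I\<^sup>n\<close>,
  and in the \<open>I\<close>-adic topology the classes of \<open>x\<close> modulo \<open>I\<^sup>n\<close>, for \<open>n = 1, 2, \<dots>\<close>, form
  a neighbourhood base of \<open>x\<close> (\<open>openin_adic_iff\<close>). Hence an operation that respects the congruence
  modulo every ideal is continuous: for the neighbourhood of the value given by \<open>I\<^sup>n\<close>, the
  neighbourhoods of the arguments given by the same \<open>I\<^sup>n\<close> will do
  (\<open>continuous_map_adic\<close>, \<open>continuous_map_adic2\<close>). Addition, negation and multiplication respect
  such congruences because the quotient by an ideal is a ring. Inversion of units respects them
  because the quotient map sends units to units and inverses to inverses; explicitly,
  \<open>y\<^sup>-\<^sup>1 - x\<^sup>-\<^sup>1 = x\<^sup>-\<^sup>1 y\<^sup>-\<^sup>1 (x - y)\<close>.\<close>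

context cring
begin

lemma mem_coset_iff_diff:
  assumes "ideal J R" "x \<in> carrier R" "y \<in> carrier R"
  shows "y \<in> x <+ J \<longleftrightarrow> y \<ominus> x \<in> J"
proof
  assume "y \<in> x <+ J"
  then obtain j where j: "j \<in> J" "y = x \<oplus> j"
    by (auto simp: a_l_coset_def')
  moreover have "j \<in> carrier R"
    using assms(1) j(1) by (rule ideal.Icarr)
  ultimately have "y \<ominus> x = j"
    using assms(2) by algebra
  then show "y \<ominus> x \<in> J" using j by simp
next
  assume "y \<ominus> x \<in> J"
  moreover have "y = x \<oplus> (y \<ominus> x)"
    using assms(2,3) by algebra
  ultimately show "y \<in> x <+ J"
    unfolding a_l_coset_def' by blast
qed

lemma coset_add:
  assumes J: "ideal J R"
    and carr: "x \<in> carrier R" "x' \<in> carrier R" "y \<in> carrier R" "y' \<in> carrier R"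
    and "x' \<in> x <+ J" "y' \<in> y <+ J"
  shows "x' \<oplus> y' \<in> (x \<oplus> y) <+ J"
proof -
  interpret ideal J R by fact
  have "x' \<ominus> x \<in> J" "y' \<ominus> y \<in> J"
    using assms by (simp_all add: mem_coset_iff_diff)
  then have "(x' \<ominus> x) \<oplus> (y' \<ominus> y) \<in> J" by simp
  moreover have "(x' \<ominus> x) \<oplus> (y' \<ominus> y) = (x' \<oplus> y') \<ominus> (x \<oplus> y)"
    using carr by algebra
  ultimately show ?thesis using carr J by (simp add: mem_coset_iff_diff)
qed

lemma coset_minus:
  assumes J: "ideal J R"
    and carr: "x \<in> carrier R" "x' \<in> carrier R"
    and "x' \<in> x <+ J"
  shows "\<ominus> x' \<in> (\<ominus> x) <+ J"
proof -
  interpret ideal J R by fact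
  have "x' \<ominus> x \<in> J"
    using assms by (simp add: mem_coset_iff_diff)
  then have "\<ominus> (x' \<ominus> x) \<in> J" by simp
  moreover have "\<ominus> (x' \<ominus> x) = (\<ominus> x') \<ominus> (\<ominus> x)"
    using carr by algebra
  ultimately show ?thesis using carr J by (simp add: mem_coset_iff_diff)
qed

lemma coset_mult:
  assumes J: "ideal J R"
    and carr: "x \<in> carrier R" "x' \<in> carrier R" "y \<in> carrier R" "y' \<in> carrier R"
    and "x' \<in> x <+ J" "y' \<in> y <+ J"
  shows "x' \<otimes> y' \<in> (x \<otimes> y) <+ J"
proof -
  interpret ideal J R by fact
  have "x' \<ominus> x \<in> J" "y' \<ominus> y \<in> J"
    using assms by (simp_all add: mem_coset_iff_diff)
  then have "(x' \<ominus> x) \<otimes> y' \<oplus> x \<otimes> (y' \<ominus> y) \<in> J"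
    using carr by (simp add: I_l_closed I_r_closed)
  moreover have "(x' \<ominus> x) \<otimes> y' \<oplus> x \<otimes> (y' \<ominus> y) = (x' \<otimes> y') \<ominus> (x \<otimes> y)"
    using carr by algebra
  ultimately show ?thesis using carr J by (simp add: mem_coset_iff_diff)
qed

lemma coset_inv:
  assumes J: "ideal J R" and units: "x \<in> Units R" "y \<in> Units R" and "y \<in> x <+ J"
  shows "inv y \<in> (inv x) <+ J"
proof -
  interpret ideal J R by fact
  have carr: "x \<in> carrier R" "y \<in> carrier R" "inv x \<in> carrier R" "inv y \<in> carrier R"
    using units by auto
  have inverses: "x \<otimes> inv x = \<one>" "y \<otimes> inv y = \<one>"
    using units by auto
  have "y \<ominus> x \<in> J"
    using assms carr by (simp add: mem_coset_iff_diff)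
  then have "\<ominus> (inv x \<otimes> inv y \<otimes> (y \<ominus> x)) \<in> J"
    using carr by (simp add: I_l_closed)
  moreover have "\<ominus> (inv x \<otimes> inv y \<otimes> (y \<ominus> x)) = inv y \<ominus> inv x"
  proof -
    have "\<ominus> (inv x \<otimes> inv y \<otimes> (y \<ominus> x)) = inv y \<otimes> (x \<otimes> inv x) \<ominus> inv x \<otimes> (y \<otimes> inv y)"
      using carr by algebra
    then show ?thesis using carr inverses by simp
  qed
  ultimately show ?thesis using carr J by (simp add: mem_coset_iff_diff)
qed

lemma openin_adic_iff:
  assumes I: "ideal I R"
  shows "openin (adic_topology R I) U \<longleftrightarrow>
    U \<subseteq> carrier R \<and> (\<forall>x\<in>U. \<exists>n\<ge>1. x <+ (I [^]\<^bsub>ideals_set R\<^esub> (n::nat)) \<subseteq> U)"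
proof
  assume "openin (adic_topology R I) U"
  then obtain \<B> where \<B>: "\<B> \<subseteq> adic_base R I" "U = \<Union>\<B>"
    using openin_adic_topology[OF I] by auto
  have "x \<in> carrier R \<and> (\<exists>n\<ge>1. x <+ (I [^]\<^bsub>ideals_set R\<^esub> (n::nat)) \<subseteq> U)" if "x \<in> U" for x
  proof -
    from that \<B> obtain B where B: "B \<in> adic_base R I" "x \<in> B" "B \<subseteq> U"
      by blast
    then obtain a and n :: nat where
      a: "a \<in> carrier R" "n \<ge> 1" "x \<in> a <+ (I [^]\<^bsub>ideals_set R\<^esub> n)"
        "a <+ (I [^]\<^bsub>ideals_set R\<^esub> n) \<subseteq> U"
      unfolding adic_base_def by blast
    have "x <+ (I [^]\<^bsub>ideals_set R\<^esub> n) \<subseteq> a <+ (I [^]\<^bsub>ideals_set R\<^esub> n)"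
      using a by (intro coset_subset_coset ideal_pow_is_ideal I) auto
    moreover have "x \<in> carrier R"
      using a coset_in_carrier[OF ideal_pow_is_ideal[OF I]] by blast
    ultimately show ?thesis using a by blast
  qed
  then show "U \<subseteq> carrier R \<and> (\<forall>x\<in>U. \<exists>n\<ge>1. x <+ (I [^]\<^bsub>ideals_set R\<^esub> (n::nat)) \<subseteq> U)"
    by blast
next
  assume U: "U \<subseteq> carrier R \<and> (\<forall>x\<in>U. \<exists>n\<ge>1. x <+ (I [^]\<^bsub>ideals_set R\<^esub> (n::nat)) \<subseteq> U)"
  have "\<exists>B \<in> adic_base R I. x \<in> B \<and> B \<subseteq> U" if "x \<in> U" for x
  proof -
    from that U obtain n :: nat where
      n: "n \<ge> 1" "x <+ (I [^]\<^bsub>ideals_set R\<^esub> n) \<subseteq> U" and x: "x \<in> carrier R"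
      by blast
    moreover have "x \<in> x <+ (I [^]\<^bsub>ideals_set R\<^esub> n)"
      by (rule mem_coset_self[OF ideal_pow_is_ideal[OF I] x])
    ultimately show ?thesis unfolding adic_base_def by blast
  qed
  then have "U = \<Union>{B \<in> adic_base R I. B \<subseteq> U}" by blast
  then show "openin (adic_topology R I) U"
    unfolding openin_adic_topology[OF I]
    by (intro exI[of _ "{B \<in> adic_base R I. B \<subseteq> U}"] conjI) auto
qed

lemma topspace_adic:
  assumes I: "ideal I R"
  shows "topspace (adic_topology R I) = carrier R"
proof (rule subset_antisym)
  show "topspace (adic_topology R I) \<subseteq> carrier R"
    using openin_adic_iff[OF I] openin_topspace by blast
  have "openin (adic_topology R I) (carrier R)"
    unfolding openin_adic_iff[OF I]
    using coset_in_carrier[OF ideal_pow_is_ideal[OF I]] by blast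
  then show "carrier R \<subseteq> topspace (adic_topology R I)"
    by (rule openin_subset)
qed

lemma openin_adic_coset:
  assumes I: "ideal I R" and "n \<ge> 1" "a \<in> carrier R"
  shows "openin (adic_topology R I) (a <+ (I [^]\<^bsub>ideals_set R\<^esub> (n::nat)))"
proof -
  have "a <+ (I [^]\<^bsub>ideals_set R\<^esub> n) \<in> adic_base R I"
    unfolding adic_base_def using assms by blast
  then show ?thesis
    unfolding openin_adic_topology[OF I]
    by (intro exI[of _ "{a <+ (I [^]\<^bsub>ideals_set R\<^esub> n)}"]) simp
qed

text \<open>The operation is required to respect congruences only between elements of a subset \<open>S\<close>, so
  that \<open>S\<close> can be the whole ring as well as its group of units, where inversion is defined.\<close>

lemma continuous_map_adic:
  assumes I: "ideal I R" and S: "S \<subseteq> carrier R"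
    and closed: "\<And>x. x \<in> S \<Longrightarrow> f x \<in> S"
    and cong: "\<And>J x x'. \<lbrakk>ideal J R; x \<in> S; x' \<in> S; x' \<in> x <+ J\<rbrakk> \<Longrightarrow> f x' \<in> f x <+ J"
  shows "continuous_map (subtopology (adic_topology R I) S) (subtopology (adic_topology R I) S) f"
proof -
  let ?T = "adic_topology R I"
  have "\<exists>V. openin (subtopology ?T S) V \<and> x \<in> V \<and> (\<forall>x'\<in>V. f x' \<in> U)"
    if x: "x \<in> S" and U: "openin ?T U" and fx: "f x \<in> U" for x U
  proof -
    obtain n :: nat where n: "n \<ge> 1" "f x <+ (I [^]\<^bsub>ideals_set R\<^esub> n) \<subseteq> U"
      using U fx openin_adic_iff[OF I] by blast
    let ?J = "I [^]\<^bsub>ideals_set R\<^esub> n"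
    have J: "ideal ?J R" by (rule ideal_pow_is_ideal[OF I])
    have "openin (subtopology ?T S) (S \<inter> (x <+ ?J))"
      using openin_adic_coset[OF I n(1)] x S by (auto intro: openin_subtopology_Int2)
    moreover have "x \<in> S \<inter> (x <+ ?J)"
      using x S mem_coset_self[OF J] by blast
    moreover have "\<forall>x' \<in> S \<inter> (x <+ ?J). f x' \<in> U"
      using cong[OF J x] n(2) by blast
    ultimately show ?thesis by blast
  qed
  then have "continuous_map (subtopology ?T S) ?T f"
    using S closed topspace_adic[OF I]
    by (simp add: Int_absorb1 continuous_map_eq_topcontinuous_at topcontinuous_at_def) blast
  then show ?thesis
    using closed by (auto simp: continuous_map_in_subtopology)
qed

lemma continuous_map_adic2:
  assumes I: "ideal I R" and S: "S \<subseteq> carrier R"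
    and closed: "\<And>x y. \<lbrakk>x \<in> S; y \<in> S\<rbrakk> \<Longrightarrow> f x y \<in> S"
    and cong: "\<And>J x x' y y'. \<lbrakk>ideal J R; x \<in> S; x' \<in> S; y \<in> S; y' \<in> S; x' \<in> x <+ J; y' \<in> y <+ J\<rbrakk>
      \<Longrightarrow> f x' y' \<in> f x y <+ J"
  shows "continuous_map
    (prod_topology (subtopology (adic_topology R I) S) (subtopology (adic_topology R I) S))
    (subtopology (adic_topology R I) S) (\<lambda>(x, y). f x y)"
proof -
  let ?T = "adic_topology R I"
  let ?P = "prod_topology (subtopology ?T S) (subtopology ?T S)"
  have nbhd: "\<exists>V. openin ?P V \<and> (x, y) \<in> V \<and> (\<forall>z \<in> V. case_prod f z \<in> U)"
    if x: "x \<in> S" and y: "y \<in> S" and U: "openin ?T U" and fxy: "f x y \<in> U" for x y U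
  proof -
    obtain n :: nat where n: "n \<ge> 1" "f x y <+ (I [^]\<^bsub>ideals_set R\<^esub> n) \<subseteq> U"
      using U fxy openin_adic_iff[OF I] by blast
    let ?J = "I [^]\<^bsub>ideals_set R\<^esub> n"
    let ?V = "(S \<inter> (x <+ ?J)) \<times> (S \<inter> (y <+ ?J))"
    have J: "ideal ?J R" by (rule ideal_pow_is_ideal[OF I])
    have "openin ?P ?V"
      using openin_adic_coset[OF I n(1)] x y S
      by (auto simp: openin_prod_Times_iff intro: openin_subtopology_Int2)
    moreover have "(x, y) \<in> ?V"
      using x y S mem_coset_self[OF J] by blast
    moreover have "f x' y' \<in> U" if "x' \<in> S" "y' \<in> S" "x' \<in> x <+ ?J" "y' \<in> y <+ ?J" for x' y'
      using cong[OF J x that(1) y that(2-4)] n(2) by blast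
    then have "\<forall>z \<in> ?V. case_prod f z \<in> U" by auto
    ultimately show ?thesis by (intro exI[of _ ?V] conjI)
  qed
  have top: "topspace ?T = carrier R" by (rule topspace_adic[OF I])
  then have topP: "topspace ?P = S \<times> S"
    using S by (simp add: Int_absorb1)
  have maps: "case_prod f \<in> S \<times> S \<rightarrow> S"
    using closed by auto
  then have "case_prod f \<in> S \<times> S \<rightarrow> carrier R"
    using S by blast
  then have "topcontinuous_at ?P ?T (case_prod f) (x, y)" if "x \<in> S" "y \<in> S" for x y
    unfolding topcontinuous_at_def topP top using that nbhd[OF that] by simp
  then have "continuous_map ?P ?T (case_prod f)"
    unfolding continuous_map_eq_topcontinuous_at topP by blast
  then show ?thesis
    using maps by (simp add: continuous_map_in_subtopology topP[simplified])
qed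

lemma topological_ring_adic:
  assumes I: "ideal I R"
  shows "topological_ring R (adic_topology R I)"
proof
  let ?T = "adic_topology R I"
  show top: "topspace ?T = carrier R" by (rule topspace_adic[OF I])
  have sub: "subtopology ?T (carrier R) = ?T"
    unfolding top[symmetric] by simp
  show "continuous_map (prod_topology ?T ?T) ?T (\<lambda>(x, y). x \<oplus> y)"
    using continuous_map_adic2[OF I, of "carrier R" "(\<oplus>)"] coset_add unfolding sub by simp
  show "continuous_map ?T ?T (\<lambda>x. \<ominus> x)"
    using continuous_map_adic[OF I, of "carrier R" "\<lambda>x. \<ominus> x"] coset_minus unfolding sub by simp
  show "continuous_map (prod_topology ?T ?T) ?T (\<lambda>(x, y). x \<otimes> y)"
    using continuous_map_adic2[OF I, of "carrier R" "(\<otimes>)"] coset_mult unfolding sub by simp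
qed

lemma topological_group_units_adic:
  assumes I: "ideal I R"
  shows "topological_group (units_of R) (subtopology (adic_topology R I) (Units R))"
proof (intro topological_group.intro topological_group_axioms.intro)
  let ?T = "subtopology (adic_topology R I) (Units R)"
  have carr: "Units R \<subseteq> carrier R" by auto
  show "group (units_of R)" by (rule units_group)
  show "topspace ?T = carrier (units_of R)"
    using carr by (simp add: topspace_adic[OF I] units_of_carrier Int_absorb1)
  show "continuous_map (prod_topology ?T ?T) ?T (\<lambda>(x, y). x \<otimes>\<^bsub>units_of R\<^esub> y)"
    unfolding units_of_mult
    by (rule continuous_map_adic2[OF I carr]) (auto intro: coset_mult)
  have "continuous_map ?T ?T (\<lambda>x. inv x)"
    by (rule continuous_map_adic[OF I carr]) (auto intro: coset_inv)
  then show "continuous_map ?T ?T (\<lambda>x. inv\<^bsub>units_of R\<^esub> x)"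
    by (rule continuous_map_eq) (simp add: units_of_inv)
qed

end

theorem theorem2p2:
  fixes R :: "('a, 'b) ring_scheme" and I :: "'a set"
  assumes "cring R" and "ideal I R"
  shows "absolute_topological_ring R (adic_topology R I)"
  using cring.topological_ring_adic[OF assms] cring.topological_group_units_adic[OF assms]
  by (intro absolute_topological_ring.intro absolute_topological_ring_axioms.intro)

end
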